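(* Let $D$ be a twin-free digraph with minimum in-degree $\delta^-\ge 1$, and let $F_1,\dots,F_{11}$ be the eleven digraphs listed in the context. (i) If $\delta^-\ge 2$ and $D$ does not contain $F_1$ nor $F_2$ as a subdigraph, then $D$ admits a $(1,\le \delta^--1)$-identifying code. (ii) If $D$ is an oriented graph and does not contain $F_1$ nor $F_2$ as a subdigraph, then $D$ admits a $(1,\le \delta^-)$-identifying code. (iii) If $D$ does not contain any of $F_1,\dots,F_9$ as a subdigraph, then $D$ admits a $(1,\le \delta^-)$-identifying code. (iv) If $\delta^-\ge 2$, no vertex of in-degree $\delta^-$ lies on a digon, and $D$ does not contain any of $F_1,\dots,F_{11}$ as a subdigraph, then $D$ admits a $(1,\le \delta^-+1)$-identifying code. (v) If $\delta^-=1$, no vertex of in-degree $1$ lies on a directed cycle of length less than five, and $D$ does not contain any of $F_1,F_3,F_4,F_5,F_6,F_{11}$ as a subdigraph, then $D$ admits a $(1,\le 2)$-identifying code.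
   Context: Digraphs have no loops and no multiple arcs, but may contain both arcs $(u,v)$ and $(v,u)$, which then form a digon (a directed cycle of length 2). An oriented graph is a digraph without digons. For a vertex $u$, $N^-(u)=\{v:(v,u)\in A\}$, $N^-[u]=N^-(u)\cup\{u\}$, and the in-degree is $d^-(u)=|N^-(u)|$; for a vertex set $U$, $N^-[U]=\bigcup_{u\in U}N^-[u]$. $\delta^-$ is the minimum in-degree. Two distinct vertices $u,v$ are twins if $N^-[u]=N^-[v]$; $D$ is twin-free if it has no twins. For an integer $\ell\ge1$, a set $C\subseteq V$ is a $(1,\le\ell)$-identifying code in $D$ if $N^-[X]\cap C\ne N^-[Y]\cap C$ for all distinct $X,Y\subseteq V$ with $1\le|X|,|Y|\le\ell$; $D$ admits a $(1,\le\ell)$-identifying code if such a $C$ exists. "Contains $F$ as a subdigraph" means that $D$ has a (not necessarily induced) subdigraph isomorphic to $F$. Differently named vertices in each $F_i$ are distinct. Writing $a\to b$ for the arc $(a,b)$, the arc sets are: $F_1$ (the transitive tournament $TT_3$): $a\to b$, $b\to c$, $a\to c$. $F_2$: $a\to x$, $b\to x$, $a\to y$, $b\to y$. $F_3$: $a\to b$, $b\to x$, $a\to c$, $c\to x$. $F_4$: $a\to b$, $b\to c$, $c\to x$, $a\to x$. $F_5$: $a\to b$, $b\to x$, $a\to c$, $c\to d$, $d\to x$. $F_6$: $a\to x$, $a\to c$, $c\to y$, $b\to x$, $b\to y$. $F_7$: $a\to b$, $b\to c$, $c\to d$, $d\to x$, $a\to x$. $F_8$: $a\to c$, $c\to x$,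 $b\to d$, $d\to x$, $a\to y$, $b\to y$. $F_9$: $a\to x$, $a\to c$, $c\to y$, $b\to y$, $b\to d$, $d\to x$. $F_{10}$: $a\to c$, $c\to d$, $d\to x$, $a\to y$, $b\to x$, $b\to y$. $F_{11}$: $a\to c$, $c\to x$, $a\to d$, $d\to y$, $b\to x$, $b\to y$. *)

theory Defs
  imports "Graph_Theory.Pair_Digraph" "Graph_Theory.Digraph_Isomorphism"
begin

text \<open>
  Digraphs are finite, loopless and without parallel arcs (\<open>pair_digraph\<close>); the arcs are
  ordered pairs of vertices, so that digons are allowed.
\<close>

definition in_nbhd :: "'a pair_pre_digraph \<Rightarrow> 'a \<Rightarrow> 'a set" where
  "in_nbhd D u = {v. (v, u) \<in> parcs D}"

definition closed_in_nbhd :: "'a pair_pre_digraph \<Rightarrow> 'a \<Rightarrow> 'a set" where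
  "closed_in_nbhd D u = in_nbhd D u \<union> {u}"

definition closed_in_nbhd_set :: "'a pair_pre_digraph \<Rightarrow> 'a set \<Rightarrow> 'a set" where
  "closed_in_nbhd_set D U = (\<Union>u\<in>U. closed_in_nbhd D u)"

text \<open>Only meaningful for a finite nonempty vertex set.\<close>

definition min_in_degree :: "'a pair_pre_digraph \<Rightarrow> nat" where
  "min_in_degree D = Min (in_degree (with_proj D) ` pverts D)"

definition twins :: "'a pair_pre_digraph \<Rightarrow> 'a \<Rightarrow> 'a \<Rightarrow> bool" where
  "twins D u v \<longleftrightarrow> u \<in> pverts D \<and> v \<in> pverts D \<and> u \<noteq> v
     \<and> closed_in_nbhd D u = closed_in_nbhd D v"

definition twin_free :: "'a pair_pre_digraph \<Rightarrow> bool" where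
  "twin_free D \<longleftrightarrow> (\<nexists>u v. twins D u v)"

definition digon :: "'a pair_pre_digraph \<Rightarrow> 'a \<Rightarrow> 'a \<Rightarrow> bool" where
  "digon D u v \<longleftrightarrow> (u, v) \<in> parcs D \<and> (v, u) \<in> parcs D"

definition on_digon :: "'a pair_pre_digraph \<Rightarrow> 'a \<Rightarrow> bool" where
  "on_digon D u \<longleftrightarrow> (\<exists>v. digon D u v)"

definition oriented :: "'a pair_pre_digraph \<Rightarrow> bool" where
  "oriented D \<longleftrightarrow> (\<nexists>u v. digon D u v)"

text \<open>
  A cycle is represented by its list of arcs; its vertices are exactly the tails of these arcs.
\<close>

definition on_cycle_of_length :: "'a pair_pre_digraph \<Rightarrow> nat \<Rightarrow> 'a \<Rightarrow> bool" where
  "on_cycle_of_length D k u \<longleftrightarrow>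
     (\<exists>p. pre_digraph.cycle (with_proj D) p \<and> length p = k \<and> u \<in> fst ` set p)"

definition identifying_code :: "'a pair_pre_digraph \<Rightarrow> nat \<Rightarrow> 'a set \<Rightarrow> bool" where
  "identifying_code D l C \<longleftrightarrow> C \<subseteq> pverts D \<and>
     (\<forall>X Y. X \<subseteq> pverts D \<and> Y \<subseteq> pverts D \<and> X \<noteq> Y
        \<and> 1 \<le> card X \<and> card X \<le> l \<and> 1 \<le> card Y \<and> card Y \<le> l
        \<longrightarrow> closed_in_nbhd_set D X \<inter> C \<noteq> closed_in_nbhd_set D Y \<inter> C)"

definition admits_identifying_code :: "'a pair_pre_digraph \<Rightarrow> nat \<Rightarrow> bool" where
  "admits_identifying_code D l \<longleftrightarrow> (\<exists>C. identifying_code D l C)"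

definition contains_subdigraph :: "'a pair_pre_digraph \<Rightarrow> 'b pair_pre_digraph \<Rightarrow> bool" where
  "contains_subdigraph D F \<longleftrightarrow>
     (\<exists>H. subgraph (with_proj H) (with_proj D) \<and> digraph_iso (with_proj F) (with_proj H))"

datatype pattern_vertex = Va | Vb | Vc | Vd | Vx | Vy

text \<open>No pattern below has isolated vertices, so that each is determined by its arcs.\<close>

definition digraph_of_arcs :: "'a rel \<Rightarrow> 'a pair_pre_digraph" where
  "digraph_of_arcs R = \<lparr>pverts = Field R, parcs = R\<rparr>"

definition F1 :: "pattern_vertex pair_pre_digraph" where
  "F1 = digraph_of_arcs {(Va, Vb), (Vb, Vc), (Va, Vc)}"

definition F2 :: "pattern_vertex pair_pre_digraph" where
  "F2 = digraph_of_arcs {(Va, Vx), (Vb, Vx), (Va, Vy), (Vb, Vy)}"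

definition F3 :: "pattern_vertex pair_pre_digraph" where
  "F3 = digraph_of_arcs {(Va, Vb), (Vb, Vx), (Va, Vc), (Vc, Vx)}"

definition F4 :: "pattern_vertex pair_pre_digraph" where
  "F4 = digraph_of_arcs {(Va, Vb), (Vb, Vc), (Vc, Vx), (Va, Vx)}"

definition F5 :: "pattern_vertex pair_pre_digraph" where
  "F5 = digraph_of_arcs {(Va, Vb), (Vb, Vx), (Va, Vc), (Vc, Vd), (Vd, Vx)}"

definition F6 :: "pattern_vertex pair_pre_digraph" where
  "F6 = digraph_of_arcs {(Va, Vx), (Va, Vc), (Vc, Vy), (Vb, Vx), (Vb, Vy)}"

definition F7 :: "pattern_vertex pair_pre_digraph" where
  "F7 = digraph_of_arcs {(Va, Vb), (Vb, Vc), (Vc, Vd), (Vd, Vx), (Va, Vx)}"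

definition F8 :: "pattern_vertex pair_pre_digraph" where
  "F8 = digraph_of_arcs {(Va, Vc), (Vc, Vx), (Vb, Vd), (Vd, Vx), (Va, Vy), (Vb, Vy)}"

definition F9 :: "pattern_vertex pair_pre_digraph" where
  "F9 = digraph_of_arcs {(Va, Vx), (Va, Vc), (Vc, Vy), (Vb, Vy), (Vb, Vd), (Vd, Vx)}"

definition F10 :: "pattern_vertex pair_pre_digraph" where
  "F10 = digraph_of_arcs {(Va, Vc), (Vc, Vd), (Vd, Vx), (Va, Vy), (Vb, Vx), (Vb, Vy)}"

definition F11 :: "pattern_vertex pair_pre_digraph" where
  "F11 = digraph_of_arcs {(Va, Vc), (Vc, Vx), (Va, Vd), (Vd, Vy), (Vb, Vx), (Vb, Vy)}"

end

theory Submission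
  imports Defs
begin

text \<open>
  The whole vertex set serves as the code, so that the claim is that two distinct sets \<open>X\<close>, \<open>Y\<close> of
  bounded size never satisfy \<open>N\<^sup>-[X] = N\<^sup>-[Y]\<close>. Suppose they do and let \<open>x \<in> X - Y\<close>. Then \<open>N\<^sup>-[x]\<close> is covered by the
  sets \<open>N\<^sup>-[y]\<close> with \<open>y \<in> Y\<close>. If \<open>F1\<close> and \<open>F2\<close> are excluded, each \<open>y\<close> accounts for at most one in-neighbour
  of \<open>x\<close>; moreover, some \<open>s \<in> Y\<close> with \<open>x \<leadsto> s\<close> is needed to cover \<open>x\<close>, and it accounts for no in-neighbour
  except, on a digon, \<open>s\<close> itself. Hence \<open>N\<^sup>-(x) - {s}\<close> has fewer elements than \<open>Y\<close> (\<open>card_in_nbhd_less\<close>). This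
  already contradicts \<open>|Y| < \<delta>\<^sup>-\<close>, and also \<open>|Y| \<le> \<delta>\<^sup>-\<close> if there are no digons.
  
  One step beyond these bounds, the count is an equality, and \<open>X\<close> and \<open>Y\<close> determine each other
  rigidly (\<open>tightI\<close>): each vertex of \<open>X - Y\<close> has an out-neighbour \<open>s\<close> in \<open>Y\<close> and is linked with all other
  vertices of \<open>Y\<close>, by an arc from them or by a common in-neighbour, and the links are distinct; likewise
  with \<open>X\<close> and \<open>Y\<close> exchanged. The patterns \<open>F3\<close> to \<open>F11\<close> are the subdigraphs that two or three such links form
  with the arcs between \<open>X\<close> and \<open>Y\<close>. They rule out digons between \<open>X - Y\<close> and \<open>Y - X\<close> (\<open>no_digon_across\<close>), paths that
  alternate between these two sets (\<open>no_zigzag\<close>), and arcs from them into \<open>X \<inter> Y\<close> (\<open>no_arc_into_common_part\<close>),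
  which leaves no place for the out-neighbours \<open>s\<close>.
  
  For in-degree one and sets of at most two vertices, the pattern \<open>F2\<close> is allowed and counting is replaced by a
  case analysis. The arcs needed to cover the vertices of \<open>X\<close> and \<open>Y\<close> close up to short cycles, on which
  every vertex has a second in-neighbour; covering it yields one of the excluded patterns
  (\<open>overlapping_pairs\<close>, \<open>disjoint_pairs\<close>).
\<close>

section \<open>Excluded arc configurations\<close>

context pair_pre_digraph
begin

abbreviation arc_between :: "'a \<Rightarrow> 'a \<Rightarrow> bool" (infix "\<leadsto>" 50) where
  "u \<leadsto> v \<equiv> (u, v) \<in> parcs G"

end

context pair_digraph
begin

lemma no_loop [simp]: "\<not> u \<leadsto> u"
  using no_loops' by blast

lemma contains_digraph_of_arcsI:
  assumes inj: "inj_on f (Field R)" and arcs: "\<And>u v. (u, v) \<in> R \<Longrightarrow> f u \<leadsto> f v"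
  shows "contains_subdigraph G (digraph_of_arcs R)"
proof -
  define H where "H = \<lparr>pverts = f ` Field R, parcs = map_prod f f ` R\<rparr>"
  define h where "h = \<lparr>iso_verts = f, iso_arcs = map_prod f f, iso_head = snd, iso_tail = fst\<rparr>"
  have "pair_wf_digraph H"
    by unfold_locales (auto simp: H_def Field_def)
  then have "wf_digraph (with_proj H)"
    by (simp add: wf_digraph_wp_iff)
  moreover have "pverts H \<subseteq> pverts G"
    using arcs by (fastforce simp: H_def Field_def dest: wellformed')
  moreover have "parcs H \<subseteq> parcs G"
    using arcs by (auto simp: H_def)
  ultimately have sub: "subgraph (with_proj H) (with_proj G)"
    using wf_digraph_axioms by (auto simp: subgraph_def compatible_def)
  have "pair_wf_digraph (digraph_of_arcs R)"
    by unfold_locales (auto simp: digraph_of_arcs_def Field_def)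
  then have "wf_digraph (with_proj (digraph_of_arcs R))"
    by (simp add: wf_digraph_wp_iff)
  moreover have "inj_on (map_prod f f) R"
    using inj_on_subset[OF map_prod_inj_on[OF inj inj]]
    by (metis FieldI1 FieldI2 mem_Sigma_iff subrelI)
  ultimately have "pre_digraph.digraph_isomorphism (with_proj (digraph_of_arcs R)) h"
    using inj by (auto simp: pre_digraph.digraph_isomorphism_def h_def digraph_of_arcs_def)
  moreover have "with_proj H = app_iso h (with_proj (digraph_of_arcs R))"
    by (simp add: app_iso_def with_proj_def h_def H_def digraph_of_arcs_def)
  ultimately show ?thesis
    using sub unfolding contains_subdigraph_def digraph_iso_def by blast
qed

text \<open>
  A copy of a pattern is an injective placement of its vertices. In each of the following rules only
  the inequalities between vertices not joined by an arc of the pattern are premises; the others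
  follow from the absence of loops.
\<close>

lemma F1_free:
  assumes "\<not> contains_subdigraph G F1" "a \<leadsto> b" "b \<leadsto> c" "a \<leadsto> c"
  shows False
proof -
  have "a \<noteq> b" "b \<noteq> c" "a \<noteq> c"
    using assms(2-) by auto
  then have "contains_subdigraph G F1"
    unfolding F1_def using assms(2-)
    by (intro contains_digraph_of_arcsI
          [where f = "case_pattern_vertex a b c undefined undefined undefined"])
       (auto simp: inj_on_def Field_def)
  with assms(1) show False by simp
qed

lemma F2_free:
  assumes "\<not> contains_subdigraph G F2" "a \<leadsto> x" "b \<leadsto> x" "a \<leadsto> y" "b \<leadsto> y"
    "a \<noteq> b" "x \<noteq> y"
  shows False
proof -
  have "a \<noteq> x" "b \<noteq> x" "a \<noteq> y" "b \<noteq> y"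
    using assms(2-) by auto
  then have "contains_subdigraph G F2"
    unfolding F2_def using assms(2-)
    by (intro contains_digraph_of_arcsI
          [where f = "case_pattern_vertex a b undefined undefined x y"])
       (auto simp: inj_on_def Field_def)
  with assms(1) show False by simp
qed

lemma F3_free:
  assumes "\<not> contains_subdigraph G F3" "a \<leadsto> b" "b \<leadsto> x" "a \<leadsto> c" "c \<leadsto> x"
    "b \<noteq> c" "a \<noteq> x"
  shows False
proof -
  have "a \<noteq> b" "b \<noteq> x" "a \<noteq> c" "c \<noteq> x"
    using assms(2-) by auto
  then have "contains_subdigraph G F3"
    unfolding F3_def using assms(2-)
    by (intro contains_digraph_of_arcsI
          [where f = "case_pattern_vertex a b c undefined x undefined"])
       (auto simp: inj_on_def Field_def)
  with assms(1) show False by simp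
qed

lemma F4_free:
  assumes "\<not> contains_subdigraph G F4" "a \<leadsto> b" "b \<leadsto> c" "c \<leadsto> x" "a \<leadsto> x"
    "a \<noteq> c" "b \<noteq> x"
  shows False
proof -
  have "a \<noteq> b" "b \<noteq> c" "c \<noteq> x" "a \<noteq> x"
    using assms(2-) by auto
  then have "contains_subdigraph G F4"
    unfolding F4_def using assms(2-)
    by (intro contains_digraph_of_arcsI
          [where f = "case_pattern_vertex a b c undefined x undefined"])
       (auto simp: inj_on_def Field_def)
  with assms(1) show False by simp
qed

lemma F5_free:
  assumes "\<not> contains_subdigraph G F5" "a \<leadsto> b" "b \<leadsto> x" "a \<leadsto> c" "c \<leadsto> d" "d \<leadsto> x"
    "a \<noteq> d" "a \<noteq> x" "b \<noteq> c" "b \<noteq> d" "c \<noteq> x"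
  shows False
proof -
  have "a \<noteq> b" "b \<noteq> x" "a \<noteq> c" "c \<noteq> d" "d \<noteq> x"
    using assms(2-) by auto
  then have "contains_subdigraph G F5"
    unfolding F5_def using assms(2-)
    by (intro contains_digraph_of_arcsI
          [where f = "case_pattern_vertex a b c d x undefined"])
       (auto simp: inj_on_def Field_def)
  with assms(1) show False by simp
qed

lemma F6_free:
  assumes "\<not> contains_subdigraph G F6" "a \<leadsto> x" "a \<leadsto> c" "c \<leadsto> y" "b \<leadsto> x" "b \<leadsto> y"
    "a \<noteq> b" "a \<noteq> y" "b \<noteq> c" "c \<noteq> x" "x \<noteq> y"
  shows False
proof -
  have "a \<noteq> x" "a \<noteq> c" "c \<noteq> y" "b \<noteq> x" "b \<noteq> y"
    using assms(2-) by auto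
  then have "contains_subdigraph G F6"
    unfolding F6_def using assms(2-)
    by (intro contains_digraph_of_arcsI
          [where f = "case_pattern_vertex a b c undefined x y"])
       (auto simp: inj_on_def Field_def)
  with assms(1) show False by simp
qed

lemma F7_free:
  assumes "\<not> contains_subdigraph G F7" "a \<leadsto> b" "b \<leadsto> c" "c \<leadsto> d" "d \<leadsto> x" "a \<leadsto> x"
    "a \<noteq> c" "a \<noteq> d" "b \<noteq> d" "b \<noteq> x" "c \<noteq> x"
  shows False
proof -
  have "a \<noteq> b" "b \<noteq> c" "c \<noteq> d" "d \<noteq> x" "a \<noteq> x"
    using assms(2-) by auto
  then have "contains_subdigraph G F7"
    unfolding F7_def using assms(2-)
    by (intro contains_digraph_of_arcsI
          [where f = "case_pattern_vertex a b c d x undefined"])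
       (auto simp: inj_on_def Field_def)
  with assms(1) show False by simp
qed

lemma F8_free:
  assumes "\<not> contains_subdigraph G F8" "a \<leadsto> c" "c \<leadsto> x" "b \<leadsto> d" "d \<leadsto> x" "a \<leadsto> y" "b \<leadsto> y"
    "a \<noteq> b" "a \<noteq> d" "a \<noteq> x" "b \<noteq> c" "b \<noteq> x" "c \<noteq> d" "c \<noteq> y" "d \<noteq> y" "x \<noteq> y"
  shows False
proof -
  have "a \<noteq> c" "c \<noteq> x" "b \<noteq> d" "d \<noteq> x" "a \<noteq> y" "b \<noteq> y"
    using assms(2-) by auto
  then have "contains_subdigraph G F8"
    unfolding F8_def using assms(2-)
    by (intro contains_digraph_of_arcsI
          [where f = "case_pattern_vertex a b c d x y"])
       (auto simp: inj_on_def Field_def)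
  with assms(1) show False by simp
qed

lemma F9_free:
  assumes "\<not> contains_subdigraph G F9" "a \<leadsto> x" "a \<leadsto> c" "c \<leadsto> y" "b \<leadsto> y" "b \<leadsto> d" "d \<leadsto> x"
    "a \<noteq> b" "a \<noteq> d" "a \<noteq> y" "b \<noteq> c" "b \<noteq> x" "c \<noteq> d" "c \<noteq> x" "d \<noteq> y" "x \<noteq> y"
  shows False
proof -
  have "a \<noteq> x" "a \<noteq> c" "c \<noteq> y" "b \<noteq> y" "b \<noteq> d" "d \<noteq> x"
    using assms(2-) by auto
  then have "contains_subdigraph G F9"
    unfolding F9_def using assms(2-)
    by (intro contains_digraph_of_arcsI
          [where f = "case_pattern_vertex a b c d x y"])
       (auto simp: inj_on_def Field_def)
  with assms(1) show False by simp
qed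

lemma F10_free:
  assumes "\<not> contains_subdigraph G F10" "a \<leadsto> c" "c \<leadsto> d" "d \<leadsto> x" "a \<leadsto> y" "b \<leadsto> x" "b \<leadsto> y"
    "a \<noteq> b" "a \<noteq> d" "a \<noteq> x" "b \<noteq> c" "b \<noteq> d" "c \<noteq> x" "c \<noteq> y" "d \<noteq> y" "x \<noteq> y"
  shows False
proof -
  have "a \<noteq> c" "c \<noteq> d" "d \<noteq> x" "a \<noteq> y" "b \<noteq> x" "b \<noteq> y"
    using assms(2-) by auto
  then have "contains_subdigraph G F10"
    unfolding F10_def using assms(2-)
    by (intro contains_digraph_of_arcsI
          [where f = "case_pattern_vertex a b c d x y"])
       (auto simp: inj_on_def Field_def)
  with assms(1) show False by simp
qed

lemma F11_free:
  assumes "\<not> contains_subdigraph G F11" "a \<leadsto> c" "c \<leadsto> x" "a \<leadsto> d" "d \<leadsto> y" "b \<leadsto> x" "b \<leadsto> y"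
    "a \<noteq> b" "a \<noteq> x" "a \<noteq> y" "b \<noteq> c" "b \<noteq> d" "c \<noteq> d" "c \<noteq> y" "d \<noteq> x" "x \<noteq> y"
  shows False
proof -
  have "a \<noteq> c" "c \<noteq> x" "a \<noteq> d" "d \<noteq> y" "b \<noteq> x" "b \<noteq> y"
    using assms(2-) by auto
  then have "contains_subdigraph G F11"
    unfolding F11_def using assms(2-)
    by (intro contains_digraph_of_arcsI
          [where f = "case_pattern_vertex a b c d x y"])
       (auto simp: inj_on_def Field_def)
  with assms(1) show False by simp
qed

end

section \<open>Pairs of sets that the counting argument leaves open\<close>

context pair_pre_digraph
begin

text \<open>
  The vertices \<open>p\<close> with \<open>linked x y p\<close> are the elements of \<open>N\<^sup>-(x) \<inter> N\<^sup>-[y]\<close>, that is, the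
  in-neighbours of \<open>x\<close> that \<open>y\<close> accounts for when \<open>N\<^sup>-[x]\<close> has to be covered by closed in-neighbourhoods.
\<close>

definition linked :: "'a \<Rightarrow> 'a \<Rightarrow> 'a \<Rightarrow> bool" where
  "linked x y p \<longleftrightarrow> p \<leadsto> x \<and> (p = y \<or> p \<leadsto> y)"

text \<open>
  This is the extremal case of that cover: some \<open>s \<in> Y\<close> is spent on \<open>x\<close> itself, and every other
  element of \<open>Y\<close> has to account for an in-neighbour of \<open>x\<close> that nobody else accounts for. If \<open>F1\<close> is
  excluded, the only in-neighbour that \<open>s\<close> can account for is \<open>s\<close>, on a digon with \<open>x\<close>.
\<close>

definition tight :: "'a \<Rightarrow> 'a set \<Rightarrow> bool" where
  "tight x Y \<longleftrightarrow> (\<exists>s\<in>Y. x \<leadsto> s) \<and>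
     (\<forall>s\<in>Y. x \<leadsto> s \<longrightarrow> (\<forall>y\<in>Y. y \<noteq> s \<longrightarrow> (\<exists>p. linked x y p))) \<and>
     (\<forall>y\<in>Y. \<forall>y'\<in>Y. \<forall>p. linked x y p \<longrightarrow> linked x y' p \<longrightarrow> y = y')"

end

text \<open>
  Two situations lead here. If codes for sets of at most \<open>\<delta>\<^sup>-\<close> vertices are sought, then tightness
  forces digons: each arc from \<open>x \<in> X - Y\<close> into \<open>Y\<close> is reciprocated. If codes for sets of one more vertex
  are sought, then the arcs may be one-way, but both sets have at least three elements and two more
  patterns are excluded. The last assumption records this alternative; the hypotheses are symmetric in
  \<open>X\<close> and \<open>Y\<close>, so that each lemma below also holds with the two sets exchanged.
\<close>

locale tight_pair = pair_digraph +
  fixes X Y :: "'a set"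
  assumes F1: "\<not> contains_subdigraph G F1"
    and F2: "\<not> contains_subdigraph G F2"
    and F3: "\<not> contains_subdigraph G F3"
    and F4: "\<not> contains_subdigraph G F4"
    and F5: "\<not> contains_subdigraph G F5"
    and F6: "\<not> contains_subdigraph G F6"
    and F7: "\<not> contains_subdigraph G F7"
    and F8: "\<not> contains_subdigraph G F8"
    and F9: "\<not> contains_subdigraph G F9"
    and tight_X: "x \<in> X \<Longrightarrow> x \<notin> Y \<Longrightarrow> tight x Y"
    and tight_Y: "y \<in> Y \<Longrightarrow> y \<notin> X \<Longrightarrow> tight y X"
    and second_X: "\<exists>x\<in>X. x \<noteq> u"
    and second_Y: "\<exists>y\<in>Y. y \<noteq> u"
    and reciprocal_or_large:
      "((\<forall>x\<in>X - Y. \<forall>y\<in>Y. x \<leadsto> y \<longrightarrow> y \<leadsto> x) \<and> (\<forall>y\<in>Y - X. \<forall>x\<in>X. y \<leadsto> x \<longrightarrow> x \<leadsto> y))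
       \<or> (\<not> contains_subdigraph G F10 \<and> \<not> contains_subdigraph G F11 \<and>
          (\<forall>u v. \<exists>x\<in>X. x \<noteq> u \<and> x \<noteq> v) \<and> (\<forall>u v. \<exists>y\<in>Y. y \<noteq> u \<and> y \<noteq> v))"
begin

lemmas no_F1 = F1_free[OF F1] and no_F2 = F2_free[OF F2] and no_F3 = F3_free[OF F3]
  and no_F4 = F4_free[OF F4] and no_F5 = F5_free[OF F5] and no_F6 = F6_free[OF F6]
  and no_F7 = F7_free[OF F7] and no_F8 = F8_free[OF F8] and no_F9 = F9_free[OF F9]

lemma swap: "tight_pair G Y X"
proof unfold_locales
  show "((\<forall>x\<in>Y - X. \<forall>y\<in>X. x \<leadsto> y \<longrightarrow> y \<leadsto> x) \<and> (\<forall>y\<in>X - Y. \<forall>x\<in>Y. y \<leadsto> x \<longrightarrow> x \<leadsto> y))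
       \<or> (\<not> contains_subdigraph G F10 \<and> \<not> contains_subdigraph G F11 \<and>
          (\<forall>u v. \<exists>x\<in>Y. x \<noteq> u \<and> x \<noteq> v) \<and> (\<forall>u v. \<exists>y\<in>X. y \<noteq> u \<and> y \<noteq> v))"
    using reciprocal_or_large by argo
qed (use F1 F2 F3 F4 F5 F6 F7 F8 F9 tight_X tight_Y second_X second_Y in simp_all)

lemma X_partner:
  assumes "x \<in> X" "x \<notin> Y"
  obtains s where "s \<in> Y" "x \<leadsto> s"
  using tight_X[OF assms] by (auto simp: tight_def)

lemma X_linked:
  assumes "x \<in> X" "x \<notin> Y" "s \<in> Y" "x \<leadsto> s" "y \<in> Y" "y \<noteq> s"
  obtains p where "linked x y p"
  using tight_X[OF assms(1,2)] assms(3-) unfolding tight_def by blast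

lemma X_linked_inj:
  assumes "x \<in> X" "x \<notin> Y" "linked x y p" "linked x y' p" "y \<in> Y" "y' \<in> Y"
  shows "y = y'"
  using tight_X[OF assms(1,2)] assms(3-) unfolding tight_def by blast

lemmas Y_partner = tight_pair.X_partner[OF swap]
  and Y_linked = tight_pair.X_linked[OF swap]
  and Y_linked_inj = tight_pair.X_linked_inj[OF swap]

text \<open>
  Suppose a digon joins \<open>x \<in> X - Y\<close> and \<open>y \<in> Y - X\<close>. This and the next two lemmas take a further vertex
  \<open>x' \<in> X\<close> and play two ties of it against each other: its link with \<open>y\<close> and a link or an arc between it
  and another vertex of \<open>Y\<close>. Each link is a single arc or a common in-neighbour, and
  each combination closes up to a forbidden pattern around the digon. If \<open>x'\<close> were in \<open>Y\<close>, it would be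
  linked with \<open>x\<close> itself.
\<close>

lemma digon_excludes_common_vertex:
  assumes x: "x \<in> X" "x \<notin> Y" and y: "y \<in> Y" "y \<notin> X" and d: "x \<leadsto> y" "y \<leadsto> x"
    and x': "x' \<in> X" "x' \<noteq> x"
  shows "x' \<notin> Y"
proof
  assume "x' \<in> Y"
  have "x' \<noteq> y" using x' y by blast
  obtain p where p: "linked x x' p"
    using X_linked[OF x y(1) d(1) \<open>x' \<in> Y\<close> \<open>x' \<noteq> y\<close>] by blast
  obtain z where z: "linked y x' z"
    using Y_linked[OF y x(1) d(2) x'] by blast
  have "p \<noteq> y"
    using X_linked_inj[OF x p _ \<open>x' \<in> Y\<close> y(1)] d \<open>x' \<noteq> y\<close> by (auto simp: linked_def)
  have "z \<noteq> x"
    using Y_linked_inj[OF y z _ x'(1) x(1)] d x' by (auto simp: linked_def)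
  have pz: "p \<leadsto> x" "z \<leadsto> y" using p z by (auto simp: linked_def)
  have "z \<noteq> p" using pz no_F1[of z y x] d by blast
  consider (1) "p = x'" "z = x'" | (2) "p \<leadsto> x'" "z = x'" | (3) "p = x'" "z \<leadsto> x'"
    | (4) "p \<leadsto> x'" "z \<leadsto> x'"
    using p z by (auto simp: linked_def)
  then show False
  proof cases
    case 1
    with \<open>z \<noteq> p\<close> show False by simp
  next
    case 2
    with pz d \<open>p \<noteq> y\<close> x' show False using no_F4[of p x' y x] by blast
  next
    case 3
    with pz d \<open>x' \<noteq> y\<close> \<open>z \<noteq> x\<close> show False using no_F3[of z x' x y] by blast
  next
    case 4
    with pz d \<open>z \<noteq> p\<close> \<open>z \<noteq> x\<close> x' \<open>x' \<noteq> y\<close> \<open>p \<noteq> y\<close> show False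
      using no_F6[of z x' y x p] by blast
  qed
qed

lemmas digon_excludes_common_vertex' = tight_pair.digon_excludes_common_vertex[OF swap]

text \<open>
  If \<open>x' \<leadsto> y\<close>, then the path \<open>x' \<leadsto> y \<leadsto> x\<close> meets any other vertex \<open>y'\<close> of \<open>Y\<close> twice: \<open>y'\<close> is linked
  with \<open>x\<close> through some \<open>w\<close>, and with \<open>x'\<close> through some \<open>q\<close> unless \<open>x' \<leadsto> y'\<close>.
\<close>

lemma digon_excludes_second_in_neighbour:
  assumes x: "x \<in> X" "x \<notin> Y" and y: "y \<in> Y" "y \<notin> X" and d: "x \<leadsto> y" "y \<leadsto> x"
    and x': "x' \<in> X" "x' \<noteq> x"
  shows "\<not> x' \<leadsto> y"
proof
  assume x'y: "x' \<leadsto> y"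
  obtain y' where y': "y' \<in> Y" "y' \<noteq> y" using second_Y by blast
  have "x' \<notin> Y" "y' \<notin> X"
    using digon_excludes_common_vertex[OF x y d x']
      digon_excludes_common_vertex'[OF y x d(2,1) y'] by auto
  then have ne: "y' \<noteq> x" "x' \<noteq> y" "y' \<noteq> x'" using x y x' y' by auto
  obtain w where w: "linked x y' w"
    using X_linked[OF x y(1) d(1) y'] by blast
  have "w \<leadsto> x" using w by (simp add: linked_def)
  have "w \<noteq> y"
    using X_linked_inj[OF x w _ y'(1) y(1)] d y' by (auto simp: linked_def)
  have "w \<noteq> x'" using \<open>w \<leadsto> x\<close> x'y d no_F1 by blast
  show False
  proof (cases "x' \<leadsto> y'")
    case True
    show False
    proof (cases "w = y'")
      case True
      with \<open>x' \<leadsto> y'\<close> x'y d y' x' \<open>w \<leadsto> x\<close> show False using no_F3[of x' y x y'] by blast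
    next
      case False
      then have "w \<leadsto> y'" using w by (simp add: linked_def)
      with True x'y d \<open>w \<leadsto> x\<close> \<open>w \<noteq> y\<close> \<open>w \<noteq> x'\<close> ne y' x' show False
        using no_F6[of x' y' y x w] by blast
    qed
  next
    case False
    obtain s where s: "s \<in> Y" "x' \<leadsto> s" using X_partner[OF x'(1) \<open>x' \<notin> Y\<close>] by blast
    then have "y' \<noteq> s" using False by blast
    obtain q where q: "linked x' y' q"
      using X_linked[OF x'(1) \<open>x' \<notin> Y\<close> s y'(1) \<open>y' \<noteq> s\<close>] by blast
    have "q \<leadsto> x'" using q by (simp add: linked_def)
    have "q \<noteq> y"
      using X_linked_inj[OF x'(1) \<open>x' \<notin> Y\<close> q _ y'(1) y(1)] y' \<open>q \<leadsto> x'\<close>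
      by (auto simp: linked_def)
    have "q \<noteq> x" using \<open>q \<leadsto> x'\<close> x'y d no_F1 by blast
    have "w \<noteq> q"
      using no_F4[of w x' y x] \<open>q \<leadsto> x'\<close> \<open>w \<leadsto> x\<close> x'y d \<open>w \<noteq> y\<close> x' by blast
    show False
    proof (cases "q = y'")
      case True
      then have "w \<leadsto> y'" using \<open>w \<noteq> q\<close> w by (auto simp: linked_def)
      with True \<open>q \<leadsto> x'\<close> x'y d \<open>w \<leadsto> x\<close> \<open>w \<noteq> y\<close> \<open>w \<noteq> x'\<close> ne y' x' show False
        using no_F7[of w y' x' y x] by blast
    next
      case False
      then have "q \<leadsto> y'" using q by (simp add: linked_def)
      show False
      proof (cases "w = y'")
        case True
        have "q \<leadsto> y'" "y' \<leadsto> x" "q \<leadsto> x'" "x' \<leadsto> y" "y \<leadsto> x"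
          using \<open>q \<leadsto> y'\<close> \<open>w \<leadsto> x\<close> True \<open>q \<leadsto> x'\<close> x'y d by auto
        with \<open>q \<noteq> x\<close> \<open>q \<noteq> y\<close> ne y' x' show False
          using no_F5[of q y' x x' y] by blast
      next
        case False
        then have "w \<leadsto> y'" using w by (simp add: linked_def)
        with \<open>q \<leadsto> y'\<close> \<open>w \<leadsto> x\<close> \<open>q \<leadsto> x'\<close> x'y d \<open>w \<noteq> q\<close> \<open>w \<noteq> x'\<close> \<open>q \<noteq> x\<close> \<open>w \<noteq> y\<close> \<open>q \<noteq> y\<close> ne y' x'
        show False using no_F8[of w x y q x' y'] by blast
      qed
    qed
  qed
qed

lemmas digon_excludes_second_in_neighbour' =
  tight_pair.digon_excludes_second_in_neighbour[OF swap]

text \<open>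
  By the two preceding lemmas, every remaining link at the digon is a common in-neighbour of vertices
  outside \<open>X \<inter> Y\<close>. The out-neighbour \<open>s \<in> Y\<close> of \<open>x'\<close> closes the configuration: if the arc \<open>x' \<leadsto> s\<close> is
  reciprocated, the arc \<open>s \<leadsto> x'\<close> yields \<open>F9\<close>; if it is one-way, then \<open>F11\<close> is excluded and appears.
\<close>

lemma no_digon_across:
  assumes x: "x \<in> X" "x \<notin> Y" and y: "y \<in> Y" "y \<notin> X" and d: "x \<leadsto> y" "y \<leadsto> x"
  shows False
proof -
  obtain x' where x': "x' \<in> X" "x' \<noteq> x" using second_X by blast
  have "x' \<notin> Y" by (rule digon_excludes_common_vertex[OF x y d x'])
  then obtain s where s: "s \<in> Y" "x' \<leadsto> s" using X_partner[OF x'(1)] by blast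
  have "s \<noteq> y" using digon_excludes_second_in_neighbour[OF x y d x'] s by blast
  have "\<not> s \<leadsto> x"
    by (rule digon_excludes_second_in_neighbour'[OF y x d(2,1) s(1) \<open>s \<noteq> y\<close>])
  have "s \<notin> X"
    by (rule digon_excludes_common_vertex'[OF y x d(2,1) s(1) \<open>s \<noteq> y\<close>])
  obtain w where w: "linked x s w"
    using X_linked[OF x y(1) d(1) s(1) \<open>s \<noteq> y\<close>] by blast
  then have w': "w \<leadsto> x" "w \<leadsto> s" using \<open>\<not> s \<leadsto> x\<close> by (auto simp: linked_def)
  have "w \<noteq> y"
    using X_linked_inj[OF x w _ s(1) y(1)] d \<open>s \<noteq> y\<close> by (auto simp: linked_def)
  obtain z where z: "linked y x' z"
    using Y_linked[OF y x(1) d(2) x'] by blast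
  then have z': "z \<leadsto> y" "z \<leadsto> x'"
    using digon_excludes_second_in_neighbour[OF x y d x'] by (auto simp: linked_def)
  have "z \<noteq> x"
    using Y_linked_inj[OF y z _ x'(1) x(1)] d x' by (auto simp: linked_def)
  have ne: "x' \<noteq> y" "s \<noteq> x" "s \<noteq> x'" using x y x' s \<open>x' \<notin> Y\<close> by auto
  have "z \<noteq> w" using no_F1[of w x y] w' z' d by blast
  have "z \<noteq> s" using no_F3[of w s y x] w' z' d ne \<open>w \<noteq> y\<close> by blast
  have "w \<noteq> x'" using no_F3[of z x' x y] w' z' d ne \<open>z \<noteq> x\<close> by blast
  show False
  proof (cases "s \<leadsto> x'")
    case True
    with w' z' d ne x' \<open>s \<noteq> y\<close> \<open>w \<noteq> y\<close> \<open>z \<noteq> x\<close> \<open>z \<noteq> w\<close> \<open>z \<noteq> s\<close> \<open>w \<noteq> x'\<close> show False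
      using no_F9[of w x s x' z y] by blast
  next
    case False
    then have "\<not> contains_subdigraph G F11"
      using reciprocal_or_large s x' \<open>x' \<notin> Y\<close> by blast
    from F11_free[OF this, of z y x x' s w] show False
      using w' z' d s ne x' \<open>s \<noteq> y\<close> \<open>w \<noteq> y\<close> \<open>z \<noteq> x\<close> \<open>z \<noteq> w\<close> \<open>z \<noteq> s\<close> \<open>w \<noteq> x'\<close> by blast
  qed
qed

text \<open>
  Consider a path \<open>x \<leadsto> y \<leadsto> x0 \<leadsto> y'\<close> that alternates between \<open>X\<close> and \<open>Y\<close>. A third element
  \<open>y2\<close> of \<open>Y\<close> is linked with both \<open>x\<close> and \<open>x0\<close>, because it is neither \<open>y\<close> nor \<open>y'\<close>. Together with the
  path \<open>x \<leadsto> y \<leadsto> x0\<close> the two links form \<open>F4\<close>, \<open>F5\<close>, \<open>F7\<close> or \<open>F10\<close>. The link \<open>v\<close> between \<open>x\<close> and \<open>y'\<close> only serves to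
  keep the first of them away from \<open>x0\<close>.
\<close>

lemma no_zigzag:
  assumes x: "x \<in> X" "x \<notin> Y" and y: "y \<in> Y" "y \<notin> X" and x0: "x0 \<in> X" "x0 \<notin> Y"
    and path: "x \<leadsto> y" "y \<leadsto> x0"
  shows False
proof -
  have nyx: "\<not> y \<leadsto> x" using no_digon_across[OF x y path(1)] by blast
  then have large: "\<not> contains_subdigraph G F10" "\<exists>y\<in>Y. y \<noteq> u \<and> y \<noteq> v" for u v
    using reciprocal_or_large x y path(1) by blast+
  have "x \<noteq> x0" using nyx path by blast
  obtain y' where y': "y' \<in> Y" "x0 \<leadsto> y'" using X_partner[OF x0] by blast
  have "y' \<noteq> y" using no_digon_across[OF x0 y _ path(2)] y' by blast
  obtain y2 where y2: "y2 \<in> Y" "y2 \<noteq> y" "y2 \<noteq> y'" using large(2) by blast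
  have ne: "x \<noteq> y" "x \<noteq> y'" "x \<noteq> y2" "x0 \<noteq> y" "x0 \<noteq> y'" "x0 \<noteq> y2"
    using x x0 y y' y2 by auto
  obtain v where v: "linked x y' v"
    using X_linked[OF x y(1) path(1) y'(1) \<open>y' \<noteq> y\<close>] by blast
  obtain w where w: "linked x y2 w"
    using X_linked[OF x y(1) path(1) y2(1,2)] by blast
  obtain q where q: "linked x0 y2 q"
    using X_linked[OF x0 y' y2(1,3)] by blast
  have arcs: "v \<leadsto> x" "w \<leadsto> x" "q \<leadsto> x0" using v w q by (auto simp: linked_def)
  have "w \<noteq> y" "v \<noteq> y" using nyx arcs by auto
  have "q \<noteq> y"
    using X_linked_inj[OF x0 q _ y2(1) y(1)] path y2 by (auto simp: linked_def)
  have "q \<noteq> x" using no_F1[of x y x0] arcs path by blast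
  (* An arc from x0 to x would make x0 a possible link of x with y2; but then x0 cannot
     also be its link with y', and no other link with y' is compatible with the path. *)
  have "w \<noteq> x0"
  proof
    assume "w = x0"
    have "v \<noteq> x0" 
      using X_linked_inj[OF x v _ y'(1) y2(1)] w y2 \<open>w = x0\<close> by auto
    show False
    proof (cases "v = y'")
      case True
      then show False using no_F1[of x0 y' x] arcs y' \<open>w = x0\<close> by blast
    next
      case False
      then have "v \<leadsto> y'" using v by (simp add: linked_def)
      then show False
        using no_F7[of v x y x0 y'] arcs path y' ne \<open>v \<noteq> y\<close> \<open>v \<noteq> x0\<close> \<open>x \<noteq> x0\<close> \<open>y' \<noteq> y\<close> by blast
    qed
  qed
  have "w \<noteq> q"
    using no_F4[of w x y x0] arcs path \<open>w \<noteq> y\<close> \<open>x \<noteq> x0\<close> by blast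
  consider (1) "w = y2" "q \<leadsto> y2" | (2) "w \<leadsto> y2" "q = y2" | (3) "w \<leadsto> y2" "q \<leadsto> y2"
    using w q \<open>w \<noteq> q\<close> by (auto simp: linked_def)
  then show False
  proof cases
    case 1
    then show False
      using no_F7[of q y2 x y x0] arcs path ne y2 \<open>q \<noteq> x\<close> \<open>q \<noteq> y\<close> \<open>x \<noteq> x0\<close> by blast
  next
    case 2
    then show False
      using no_F5[of w y2 x0 x y] arcs path ne y2 \<open>w \<noteq> y\<close> \<open>w \<noteq> x0\<close> \<open>x \<noteq> x0\<close> by blast
  next
    case 3
    then show False
      using F10_free[OF large(1), of w x y x0 y2 q] arcs path ne y2
        \<open>w \<noteq> y\<close> \<open>w \<noteq> x0\<close> \<open>w \<noteq> q\<close> \<open>q \<noteq> x\<close> \<open>q \<noteq> y\<close> \<open>x \<noteq> x0\<close> by blast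
  qed
qed

text \<open>
  An arc from \<open>x \<in> X - Y\<close> to \<open>c \<in> X \<inter> Y\<close> makes every \<open>y \<in> Y - X\<close> linked with \<open>x\<close>; as \<open>c\<close> lies in \<open>X\<close> as
  well, \<open>y\<close> is also tied to \<open>c\<close>, by an arc \<open>y \<leadsto> c\<close> or by a link. If \<open>x\<close> and \<open>y\<close> have a common in-neighbour,
  these ties contradict each other at once. Otherwise \<open>y \<leadsto> x\<close> is a one-way arc, \<open>y \<leadsto> x \<leadsto> c \<leadsto> y\<close> turns out to
  be a triangle, and a third element \<open>x2\<close> of \<open>X\<close> has no place next to it.
\<close>

lemma no_arc_into_common_part:
  assumes x: "x \<in> X" "x \<notin> Y" and c: "c \<in> X" "c \<in> Y" and y: "y \<in> Y" "y \<notin> X"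
    and xc: "x \<leadsto> c"
  shows False
proof -
  have ne: "x \<noteq> c" "y \<noteq> c" "x \<noteq> y" using x c y by auto
  obtain p where p: "linked x y p" using X_linked[OF x c(2) xc y(1) ne(2)] by blast
  have "p \<leadsto> x" using p by (simp add: linked_def)
  have "p \<noteq> c"
    using X_linked_inj[OF x p _ y(1) c(2)] ne \<open>p \<leadsto> x\<close> by (auto simp: linked_def)
  show False
  proof (cases "p = y")
    case True
    then have yx: "y \<leadsto> x" using \<open>p \<leadsto> x\<close> by simp
    have nxy: "\<not> x \<leadsto> y" using no_digon_across[OF x y _ yx] by blast
    then obtain x2 where x2: "x2 \<in> X" "x2 \<noteq> x" "x2 \<noteq> c"
      using reciprocal_or_large x y yx by blast
    obtain u where u: "linked y c u" using Y_linked[OF y x(1) yx c(1)] ne by blast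
    have cy: "c \<leadsto> y"
    proof (rule ccontr)
      assume "\<not> c \<leadsto> y"
      then have "u \<leadsto> y" "u \<leadsto> c" using u by (auto simp: linked_def)
      then show False using no_F4[of u y x c] yx xc nxy ne by blast
    qed
    obtain u2 where u2: "linked y x2 u2" using Y_linked[OF y x(1) yx x2(1,2)] by blast
    have "u2 \<leadsto> y" using u2 by (simp add: linked_def)
    have "u2 \<noteq> c"
      using Y_linked_inj[OF y u2 _ x2(1) c(1)] x2 cy by (auto simp: linked_def)
    have "u2 \<noteq> x" using \<open>u2 \<leadsto> y\<close> nxy by blast
    have "x2 \<noteq> y" using x2 y by blast
    show False
    proof (cases "x2 \<in> Y")
      case True
      obtain w where w: "linked x x2 w"
        using X_linked[OF x c(2) xc True x2(3)] by blast
      have "w \<leadsto> x" using w by (simp add: linked_def)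
      have "w \<noteq> y"
        using X_linked_inj[OF x w _ True y(1)] yx \<open>x2 \<noteq> y\<close> by (auto simp: linked_def)
      have "u2 \<noteq> w" using no_F1[of u2 y x] \<open>u2 \<leadsto> y\<close> \<open>w \<leadsto> x\<close> yx by blast
      consider (1) "w = x2" "u2 \<leadsto> x2" | (2) "w \<leadsto> x2" "u2 = x2" | (3) "w \<leadsto> x2" "u2 \<leadsto> x2"
        using w u2 \<open>u2 \<noteq> w\<close> by (auto simp: linked_def)
      then show False
      proof cases
        case 1
        then show False
          using no_F3[of u2 x2 x y] \<open>u2 \<leadsto> y\<close> \<open>w \<leadsto> x\<close> yx \<open>x2 \<noteq> y\<close> \<open>u2 \<noteq> x\<close> by blast
      next
        case 2
        then show False
          using no_F4[of w x2 y x] \<open>u2 \<leadsto> y\<close> \<open>w \<leadsto> x\<close> yx \<open>w \<noteq> y\<close> x2 by blast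
      next
        case 3
        then show False
          using no_F6[of u2 x2 y x w] \<open>u2 \<leadsto> y\<close> \<open>w \<leadsto> x\<close> yx \<open>w \<noteq> y\<close> \<open>u2 \<noteq> w\<close> \<open>u2 \<noteq> x\<close> \<open>x2 \<noteq> y\<close> x2
          by blast
      qed
    next
      case False
      have "\<not> x2 \<leadsto> y" using no_zigzag[OF x2(1) False y x _ yx] by blast
      then have "u2 \<leadsto> x2" using u2 by (auto simp: linked_def)
      show False
      proof (cases "x2 \<leadsto> c")
        case True
        then show False
          using no_F4[of u2 x2 c y] \<open>u2 \<leadsto> x2\<close> cy \<open>u2 \<leadsto> y\<close> \<open>u2 \<noteq> c\<close> \<open>x2 \<noteq> y\<close> by blast
      next
        case nx2c: False
        obtain s where s: "s \<in> Y" "x2 \<leadsto> s" using X_partner[OF x2(1) False] by blast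
        then have "c \<noteq> s" using nx2c by blast
        then obtain q where q: "linked x2 c q" using X_linked[OF x2(1) False s c(2)] by blast
        have "q \<leadsto> x2" using q by (simp add: linked_def)
        show False
        proof (cases "q = c")
          case True
          then show False
            using no_F2[of c x2 u2 y] \<open>q \<leadsto> x2\<close> \<open>u2 \<leadsto> x2\<close> cy \<open>u2 \<leadsto> y\<close> \<open>u2 \<noteq> c\<close> \<open>x2 \<noteq> y\<close>
            by blast
        next
          case False
          then have "q \<leadsto> c" using q by (simp add: linked_def)
          have "q \<noteq> u2" using no_F1[of q c y] \<open>q \<leadsto> c\<close> cy \<open>u2 \<leadsto> y\<close> by blast
          have "q \<noteq> y" using no_F1[of y x c] \<open>q \<leadsto> c\<close> yx xc by blast
          show False
            using no_F6[of q x2 c y u2] \<open>q \<leadsto> x2\<close> \<open>q \<leadsto> c\<close> \<open>u2 \<leadsto> x2\<close> cy \<open>u2 \<leadsto> y\<close>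
              \<open>u2 \<noteq> c\<close> \<open>x2 \<noteq> y\<close> \<open>q \<noteq> u2\<close> \<open>q \<noteq> y\<close> x2 by blast
        qed
      qed
    qed
  next
    case False
    then have "p \<leadsto> y" using p by (simp add: linked_def)
    have nxy: "\<not> x \<leadsto> y" using no_F1[of p x y] \<open>p \<leadsto> x\<close> \<open>p \<leadsto> y\<close> by blast
    show False
    proof (cases "y \<leadsto> c")
      case True
      then show False
        using no_F3[of p y c x] \<open>p \<leadsto> x\<close> \<open>p \<leadsto> y\<close> xc ne \<open>p \<noteq> c\<close> by blast
    next
      case nyc: False
      obtain s where s: "s \<in> X" "y \<leadsto> s" using Y_partner[OF y] by blast
      then have "c \<noteq> s" using nyc by blast
      then obtain u where u: "linked y c u" using Y_linked[OF y s c(1)] by blast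
      have "u \<leadsto> y" using u by (simp add: linked_def)
      show False
      proof (cases "u = c")
        case True
        then show False
          using no_F4[of p x c y] \<open>p \<leadsto> x\<close> \<open>p \<leadsto> y\<close> xc \<open>u \<leadsto> y\<close> ne \<open>p \<noteq> c\<close> by blast
      next
        case False
        then have "u \<leadsto> c" using u by (simp add: linked_def)
        have "p \<noteq> u" using no_F1[of p x c] \<open>p \<leadsto> x\<close> xc \<open>u \<leadsto> c\<close> by blast
        then show False
          using no_F6[of p y x c u] \<open>p \<leadsto> x\<close> \<open>p \<leadsto> y\<close> xc \<open>u \<leadsto> y\<close> \<open>u \<leadsto> c\<close> nxy ne \<open>p \<noteq> c\<close>
          by blast
      qed
    qed
  qed
qed

lemmas no_arc_into_common_part' = tight_pair.no_arc_into_common_part[OF swap]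

text \<open>
  Otherwise leave some \<open>x \<in> X - Y\<close> along an arc into \<open>Y\<close>, and leave its head along an arc into \<open>X\<close>.
  Neither arc may enter the common part, so that the walk is a zigzag, which is excluded too.
\<close>

lemma X_subset_or_Y_subset: "X \<subseteq> Y \<or> Y \<subseteq> X"
proof (rule ccontr)
  assume "\<not> ?thesis"
  then obtain x y where x: "x \<in> X" "x \<notin> Y" and y: "y \<in> Y" "y \<notin> X" by blast
  obtain s where s: "s \<in> Y" "x \<leadsto> s" using X_partner[OF x] by blast
  have "s \<notin> X" using no_arc_into_common_part[OF x _ s(1) y s(2)] by blast
  then obtain c where c: "c \<in> X" "s \<leadsto> c" using Y_partner[OF s(1)] by blast
  have "c \<notin> Y" using no_arc_into_common_part'[OF s(1) \<open>s \<notin> X\<close> _ c(1) x c(2)] by blast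
  show False by (rule no_zigzag[OF x s(1) \<open>s \<notin> X\<close> c(1) \<open>c \<notin> Y\<close> s(2) c(2)])
qed

end

section \<open>Covering a closed in-neighbourhood\<close>

lemma mem_closed_in_nbhd_set:
  "p \<in> closed_in_nbhd_set D U \<longleftrightarrow> (\<exists>u\<in>U. p = u \<or> (p, u) \<in> parcs D)"
  by (auto simp: closed_in_nbhd_set_def closed_in_nbhd_def in_nbhd_def)

text \<open>
  The whole vertex set is the code that separates most, since closed in-neighbourhoods lie inside it.
\<close>

lemma (in pair_wf_digraph) admits_identifying_codeI:
  assumes "\<And>X Y. \<lbrakk>X \<subseteq> pverts G; Y \<subseteq> pverts G; X \<noteq> Y; 1 \<le> card X; card X \<le> l; 1 \<le> card Y; card Y \<le> l;
    closed_in_nbhd_set G X = closed_in_nbhd_set G Y\<rbrakk> \<Longrightarrow> False"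
  shows "admits_identifying_code G l"
  unfolding admits_identifying_code_def
proof
  have inside: "closed_in_nbhd_set G U \<inter> pverts G = closed_in_nbhd_set G U" if "U \<subseteq> pverts G" for U
    using that by (auto simp: mem_closed_in_nbhd_set dest: in_arcsD1)
  show "identifying_code G l (pverts G)"
    unfolding identifying_code_def
  proof (intro conjI allI impI notI)
    fix X Y
    assume XY: "X \<subseteq> pverts G \<and> Y \<subseteq> pverts G \<and> X \<noteq> Y
        \<and> 1 \<le> card X \<and> card X \<le> l \<and> 1 \<le> card Y \<and> card Y \<le> l"
      and "closed_in_nbhd_set G X \<inter> pverts G = closed_in_nbhd_set G Y \<inter> pverts G"
    then have "closed_in_nbhd_set G X = closed_in_nbhd_set G Y"
      by (simp only: inside)
    with XY show False by (intro assms[of X Y]) simp_all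
  qed simp
qed

text \<open>
  Assigning to each point one of the sets that contain it is injective; if there are at least as many
  points as sets, it is a bijection, so that no set is wasted and none shares a point with another.
\<close>

lemma cover_by_small_sets:
  assumes "finite I" and cover: "\<And>p. p \<in> U \<Longrightarrow> \<exists>i\<in>I. p \<in> L i"
    and small: "\<And>i p q. \<lbrakk>i \<in> I; p \<in> L i; q \<in> L i\<rbrakk> \<Longrightarrow> p = q"
  shows "card U \<le> card I"
    and "\<lbrakk>card I \<le> card U; i \<in> I\<rbrakk> \<Longrightarrow> \<exists>p\<in>U. p \<in> L i"
    and "\<lbrakk>card I \<le> card U; i \<in> I; j \<in> I; p \<in> L i; p \<in> L j\<rbrakk> \<Longrightarrow> i = j"
proof -
  obtain g where g: "\<And>p. p \<in> U \<Longrightarrow> g p \<in> I" "\<And>p. p \<in> U \<Longrightarrow> p \<in> L (g p)"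
    using cover by metis
  have inj: "inj_on g U"
    by (rule inj_onI) (metis g small)
  have sub: "g ` U \<subseteq> I" using g(1) by blast
  show "card U \<le> card I"
    using card_mono[OF \<open>finite I\<close> sub] card_image[OF inj] by simp
  have onto: "g ` U = I" if "card I \<le> card U"
    using card_seteq[OF \<open>finite I\<close> sub] card_image[OF inj] that by simp
  show "\<exists>p\<in>U. p \<in> L i" if "card I \<le> card U" "i \<in> I" for i
    using onto[OF that(1)] that(2) g(2) by blast
  show "i = j" if "card I \<le> card U" "i \<in> I" "j \<in> I" "p \<in> L i" "p \<in> L j" for i j p
    using onto[OF that(1)] that(2-) g(2) small by (metis imageE)
qed

context pair_digraph
begin

lemma finite_in_nbhd: "finite (in_nbhd G u)"
  by (rule finite_subset[OF _ pair_finite_verts]) (auto simp: in_nbhd_def dest: in_arcsD1)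

lemma in_degree_eq_card_in_nbhd: "in_degree (with_proj G) u = card (in_nbhd G u)"
proof -
  have "in_arcs (with_proj G) u = (\<lambda>v. (v, u)) ` in_nbhd G u"
    by (auto simp: in_arcs_def in_nbhd_def)
  then show ?thesis
    by (simp add: in_degree_def card_image inj_on_def)
qed

lemma min_in_degree_le:
  assumes "u \<in> pverts G"
  shows "min_in_degree G \<le> card (in_nbhd G u)"
  using assms pair_finite_verts
  by (simp add: min_in_degree_def flip: in_degree_eq_card_in_nbhd)

text \<open>
  Two common in-neighbours form \<open>F2\<close>, and a common in-neighbour of two vertices joined by an arc
  forms \<open>F1\<close>.
\<close>

lemma linked_unique:
  assumes "\<not> contains_subdigraph G F1" "\<not> contains_subdigraph G F2"
    and "x \<noteq> y" "linked x y p" "linked x y q"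
  shows "p = q"
  using assms F1_free[OF assms(1)] F2_free[OF assms(2), of p x q y]
  unfolding linked_def by blast

context
  fixes x :: 'a and Y :: "'a set"
  assumes F1: "\<not> contains_subdigraph G F1" and F2: "\<not> contains_subdigraph G F2"
    and fin: "finite Y" and xY: "x \<notin> Y"
    and cover: "closed_in_nbhd_set G {x} \<subseteq> closed_in_nbhd_set G Y"
begin

lemma linked_cover:
  assumes "s \<in> Y" "x \<leadsto> s" "p \<in> in_nbhd G x - {s}"
  shows "\<exists>y\<in>Y - {s}. p \<in> {p. linked x y p}"
proof -
  have px: "p \<leadsto> x" "p \<noteq> s" using assms(3) by (auto simp: in_nbhd_def)
  then obtain y where y: "y \<in> Y" "p = y \<or> p \<leadsto> y"
    using cover by (auto simp: mem_closed_in_nbhd_set subset_iff)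
  then have "y \<noteq> s" using px F1_free[OF F1, of p x s] assms(2) by blast
  then show ?thesis using y px by (auto simp: linked_def)
qed

text \<open>
  The out-neighbour \<open>s\<close> of \<open>x\<close> can account for no in-neighbour of \<open>x\<close> other than \<open>s\<close> itself, as \<open>F1\<close> is excluded.
  So all the others are left to \<open>Y - {s}\<close>, one for each of its elements at most.
\<close>

lemma card_in_nbhd_less:
  assumes "s \<in> Y" "x \<leadsto> s"
  shows "card (in_nbhd G x - {s}) < card Y"
proof -
  have "card (in_nbhd G x - {s}) \<le> card (Y - {s})"
  proof (rule cover_by_small_sets(1)[OF _ linked_cover[OF assms]])
    show "p = q" if "y \<in> Y - {s}" "p \<in> {p. linked x y p}" "q \<in> {p. linked x y p}" for y p q
      using linked_unique[OF F1 F2, of x y p q] that xY by blast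
  qed (use fin in simp)
  then show ?thesis
    using assms(1) fin by (metis card_Diff1_less le_less_trans)
qed

lemma tightI:
  assumes large: "\<And>s. \<lbrakk>s \<in> Y; x \<leadsto> s\<rbrakk> \<Longrightarrow> card Y \<le> Suc (card (in_nbhd G x - {s}))"
  shows "tight x Y"
proof -
  have uniq: "p = q" if "y \<in> Y" "linked x y p" "linked x y q" for y p q
    using linked_unique[OF F1 F2 _ that(2,3)] that(1) xY by blast
  have le: "card (Y - {s}) \<le> card (in_nbhd G x - {s})" if "s \<in> Y" "x \<leadsto> s" for s
    using large[OF that] fin that(1) by simp
  have ex: "\<exists>p. p \<noteq> s \<and> linked x y p" if "s \<in> Y" "x \<leadsto> s" "y \<in> Y" "y \<noteq> s" for s y
    using cover_by_small_sets(2)[OF _ linked_cover[OF that(1,2)] _ le[OF that(1,2)], of y]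
      uniq fin that by auto
  have disj: "y = y'"
    if "s \<in> Y" "x \<leadsto> s" "y \<in> Y - {s}" "y' \<in> Y - {s}" "linked x y p" "linked x y' p" for s y y' p
    using cover_by_small_sets(3)[OF _ linked_cover[OF that(1,2)] _ le[OF that(1,2)] that(3,4), of p]
      uniq fin that(5,6) by auto
  have "x \<in> closed_in_nbhd_set G Y"
    using cover by (auto simp: mem_closed_in_nbhd_set)
  then obtain s where s: "s \<in> Y" "x \<leadsto> s"
    using xY by (auto simp: mem_closed_in_nbhd_set)
  have only_s: "p = s" if "linked x s p" for p
    using that s F1_free[OF F1, of p x s] by (auto simp: linked_def)
  have "y = y'" if "y \<in> Y" "y' \<in> Y" "linked x y p" "linked x y' p" for y y' p
  proof (cases "y = s \<or> y' = s")
    case True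
    then have "p = s" using only_s that by blast
    then show ?thesis using ex[OF s] uniq that True by metis
  next
    case False
    then show ?thesis using disj[OF s] that by blast
  qed
  with s ex show ?thesis unfolding tight_def by blast
qed

end

text \<open>
  Under the degree condition the count leaves no slack for sets of at most \<open>l\<close> vertices: two
  indistinguishable sets have exactly \<open>l\<close> elements, hence neither contains the other, and they form a
  tight pair unless they are singletons, which are twins.
\<close>

lemma identifying_code_if_tight:
  assumes F: "\<forall>F\<in>{F1, F2, F3, F4, F5, F6, F7, F8, F9}. \<not> contains_subdigraph G F"
    and twin_free: "twin_free G"
    and deg: "\<And>x s. x \<leadsto> s \<Longrightarrow> l \<le> Suc (card (in_nbhd G x - {s}))"
    and alt: "(\<forall>x\<in>pverts G. l \<le> card (in_nbhd G x)) \<or>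
      (\<not> contains_subdigraph G F10 \<and> \<not> contains_subdigraph G F11 \<and> 3 \<le> l)"
  shows "admits_identifying_code G l"
proof (rule admits_identifying_codeI)
  fix X Y
  assume V: "X \<subseteq> pverts G" "Y \<subseteq> pverts G" and "X \<noteq> Y"
    and cards: "1 \<le> card X" "card X \<le> l" "1 \<le> card Y" "card Y \<le> l"
    and eq: "closed_in_nbhd_set G X = closed_in_nbhd_set G Y"
  have F1: "\<not> contains_subdigraph G F1" and F2: "\<not> contains_subdigraph G F2" using F by auto
  have fin: "finite X" "finite Y"
    using cards card.infinite by fastforce+
  have cover: "closed_in_nbhd_set G {x} \<subseteq> closed_in_nbhd_set G B"
    if "x \<in> A" "closed_in_nbhd_set G A = closed_in_nbhd_set G B" for x A B
    using that by (force simp: mem_closed_in_nbhd_set)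
  have full: "card B = l"
    if "x \<in> A" "x \<notin> B" "closed_in_nbhd_set G A = closed_in_nbhd_set G B" "finite B" "card B \<le> l"
    for x A B
  proof -
    have "x \<in> closed_in_nbhd_set G B" using cover[OF that(1,3)] by (auto simp: mem_closed_in_nbhd_set)
    then obtain s where "s \<in> B" "x \<leadsto> s" using \<open>x \<notin> B\<close> by (auto simp: mem_closed_in_nbhd_set)
    with card_in_nbhd_less[OF F1 F2 that(4,2) cover[OF that(1,3)]] deg that(5)
    show ?thesis by fastforce
  qed
  (* If all in-degrees are at least l, then l - 1 vertices cannot account for all in-neighbours
     of x, so that s has to account for one. *)
  have reciprocal: "s \<leadsto> x"
    if "x \<in> A" "x \<notin> B" "closed_in_nbhd_set G A = closed_in_nbhd_set G B" "finite B" "card B \<le> l"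
      "s \<in> B" "x \<leadsto> s" "\<forall>x\<in>pverts G. l \<le> card (in_nbhd G x)" for x s A B
  proof (rule ccontr)
    assume "\<not> s \<leadsto> x"
    then have "in_nbhd G x - {s} = in_nbhd G x" by (auto simp: in_nbhd_def)
    with card_in_nbhd_less[OF F1 F2 that(4,2) cover[OF that(1,3)] that(6,7)] that(5,7,8)
    show False by (auto dest!: in_arcsD1)
  qed
  have "\<not> X \<subseteq> Y"
    using full[OF _ _ eq[symmetric] fin(1) cards(2)] \<open>X \<noteq> Y\<close> psubset_card_mono[OF fin(2), of X] cards
    by fastforce
  moreover have "\<not> Y \<subseteq> X"
    using full[OF _ _ eq fin(2) cards(4)] \<open>X \<noteq> Y\<close> psubset_card_mono[OF fin(1), of Y] cards
    by fastforce
  ultimately have card: "card X = l" "card Y = l"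
    using full[OF _ _ eq[symmetric] fin(1) cards(2)] full[OF _ _ eq fin(2) cards(4)] by blast+
  have "l \<noteq> 1"
  proof
    assume "l = 1"
    then obtain x y where "X = {x}" "Y = {y}" using card by (auto simp: card_1_singleton_iff)
    then have "twins G x y"
      using eq V \<open>X \<noteq> Y\<close> by (auto simp: twins_def closed_in_nbhd_set_def)
    then show False using twin_free by (auto simp: twin_free_def)
  qed
  then have "2 \<le> l" using cards by simp
  have second: "\<exists>a\<in>A. a \<noteq> u" if "card A = l" for A :: "'a set" and u
    using card_mono[of "{u}" A] \<open>2 \<le> l\<close> that by fastforce
  have third: "\<exists>a\<in>A. a \<noteq> u \<and> a \<noteq> v" if "card A = l" "3 \<le> l" for A :: "'a set" and u v
  proof (rule ccontr)
    assume "\<not> ?thesis"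
    then have "card A \<le> card {u, v}" by (intro card_mono) auto
    with that show False using card_insert_le_m1[of 2 "{v}" u] by simp
  qed
  have "tight_pair G X Y"
  proof unfold_locales
    show "tight x Y" if "x \<in> X" "x \<notin> Y" for x
      by (rule tightI[OF F1 F2 fin(2) that(2) cover[OF that(1) eq]]) (simp add: card deg)
    show "tight y X" if "y \<in> Y" "y \<notin> X" for y
      by (rule tightI[OF F1 F2 fin(1) that(2) cover[OF that(1) eq[symmetric]]]) (simp add: card deg)
    show "((\<forall>x\<in>X - Y. \<forall>y\<in>Y. x \<leadsto> y \<longrightarrow> y \<leadsto> x) \<and> (\<forall>y\<in>Y - X. \<forall>x\<in>X. y \<leadsto> x \<longrightarrow> x \<leadsto> y))
       \<or> (\<not> contains_subdigraph G F10 \<and> \<not> contains_subdigraph G F11 \<and>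
          (\<forall>u v. \<exists>x\<in>X. x \<noteq> u \<and> x \<noteq> v) \<and> (\<forall>u v. \<exists>y\<in>Y. y \<noteq> u \<and> y \<noteq> v))"
      using alt
    proof
      assume deg': "\<forall>x\<in>pverts G. l \<le> card (in_nbhd G x)"
      then show ?thesis
        using reciprocal[OF _ _ eq fin(2) cards(4)] reciprocal[OF _ _ eq[symmetric] fin(1) cards(2)]
        by blast
    next
      assume "\<not> contains_subdigraph G F10 \<and> \<not> contains_subdigraph G F11 \<and> 3 \<le> l"
      then show ?thesis using third card by blast
    qed
  qed (use F second card in auto)
  from tight_pair.X_subset_or_Y_subset[OF this] show False
    using \<open>\<not> X \<subseteq> Y\<close> \<open>\<not> Y \<subseteq> X\<close> by blast
qed

lemma identifying_code_if_many_in_neighbours: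
  assumes F1: "\<not> contains_subdigraph G F1" and F2: "\<not> contains_subdigraph G F2"
    and deg: "\<And>x s. x \<leadsto> s \<Longrightarrow> l \<le> card (in_nbhd G x - {s})"
  shows "admits_identifying_code G l"
proof (rule admits_identifying_codeI)
  have impossible: False
    if "x \<in> A" "x \<notin> B" "closed_in_nbhd_set G A = closed_in_nbhd_set G B" "1 \<le> card B" "card B \<le> l"
    for x A B
  proof -
    have cover: "closed_in_nbhd_set G {x} \<subseteq> closed_in_nbhd_set G B"
      using that(1,3) by (force simp: mem_closed_in_nbhd_set)
    then have "x \<in> closed_in_nbhd_set G B" by (auto simp: mem_closed_in_nbhd_set)
    then obtain s where "s \<in> B" "x \<leadsto> s" using \<open>x \<notin> B\<close> by (auto simp: mem_closed_in_nbhd_set)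
    moreover have "finite B" using that(4) card.infinite by fastforce
    ultimately show False
      using card_in_nbhd_less[OF F1 F2 _ that(2) cover] deg that(5) by fastforce
  qed
  show False
    if "X \<noteq> Y" "1 \<le> card X" "card X \<le> l" "1 \<le> card Y" "card Y \<le> l"
      "closed_in_nbhd_set G X = closed_in_nbhd_set G Y" for X Y
    using impossible[of _ X Y] impossible[of _ Y X] that by (metis subsetI subset_antisym)
qed

end

section \<open>Codes for pairs when the minimum in-degree is one\<close>

text \<open>
  Here \<open>F2\<close> is allowed, so that links are no longer unique and counting says nothing. Instead, a
  vertex on a cycle of length less than five has an in-neighbour besides its predecessor, and this
  in-neighbour has to be covered as well. With sets of at most two elements, indistinguishability
  produces a forbidden pattern or a vertex of such a cycle with no in-neighbour but its predecessor.
\<close>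

locale in_degree_one_off_short_cycles = pair_digraph +
  assumes F1: "\<not> contains_subdigraph G F1"
    and F3: "\<not> contains_subdigraph G F3"
    and F4: "\<not> contains_subdigraph G F4"
    and F5: "\<not> contains_subdigraph G F5"
    and F6: "\<not> contains_subdigraph G F6"
    and F11: "\<not> contains_subdigraph G F11"
    and in_neighbour: "u \<in> pverts G \<Longrightarrow> \<exists>z. z \<leadsto> u"
    and second_on_digon: "\<lbrakk>u \<leadsto> v; v \<leadsto> u\<rbrakk> \<Longrightarrow> \<exists>z. z \<leadsto> u \<and> z \<noteq> v"
    and second_on_triangle: "\<lbrakk>u \<leadsto> v; v \<leadsto> w; w \<leadsto> u\<rbrakk> \<Longrightarrow> \<exists>z. z \<leadsto> u \<and> z \<noteq> w"
    and second_on_square: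
      "\<lbrakk>u \<leadsto> v; v \<leadsto> w; w \<leadsto> t; t \<leadsto> u; u \<noteq> w; v \<noteq> t\<rbrakk> \<Longrightarrow> \<exists>z. z \<leadsto> u \<and> z \<noteq> t"
begin

lemmas no_F1 = F1_free[OF F1] and no_F3 = F3_free[OF F3] and no_F4 = F4_free[OF F4]
  and no_F5 = F5_free[OF F5] and no_F6 = F6_free[OF F6] and no_F11 = F11_free[OF F11]

text \<open>
  If \<open>N\<^sup>-[y] \<subseteq> N\<^sup>-[x]\<close> and \<open>y \<leadsto> x\<close>, then an in-neighbour of \<open>y\<close> other than \<open>x\<close> forms \<open>F1\<close>; so \<open>x\<close> is the only
  one, and \<open>y\<close> has in-degree one on a digon.
\<close>

lemma closed_in_nbhd_not_inside:
  assumes "y \<in> pverts G" "y \<leadsto> x"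
  shows "\<exists>z. (z = y \<or> z \<leadsto> y) \<and> \<not> (z = x \<or> z \<leadsto> x)"
  using in_neighbour[OF assms(1)] second_on_digon[of y x] assms(2) no_F1[of _ y x] by metis

lemma singleton_vs_pair:
  assumes eq: "closed_in_nbhd_set G {x} = closed_in_nbhd_set G {y1, y2}" and "y1 \<noteq> y2"
  shows False
proof -
  obtain y where y: "y \<in> {y1, y2}" "y \<noteq> x" using assms(2) by blast
  have inside: "z = x \<or> z \<leadsto> x" if "z = y \<or> z \<leadsto> y" for z
    using that y(1) eq[unfolded set_eq_iff mem_closed_in_nbhd_set] by blast
  have yx: "y \<leadsto> x" using inside[of y] y(2) by blast
  then show False using closed_in_nbhd_not_inside[OF in_arcsD1 yx] inside by blast
qed

text \<open>
  On a digon, \<open>x\<close> and \<open>y\<close> have further in-neighbours, which only \<open>s\<close> can account for, and which then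
  form \<open>F3\<close> or \<open>F6\<close> with it. If the arc is one-way, then \<open>x \<leadsto> y \<leadsto> s\<close>, and \<open>s\<close> is the only possible in-neighbour
  of \<open>x\<close>, which puts \<open>x\<close> on a triangle.
\<close>

lemma overlapping_pairs_arc:
  assumes eq: "closed_in_nbhd_set G {x, s} = closed_in_nbhd_set G {y, s}"
    and ne: "x \<noteq> y" "x \<noteq> s" "y \<noteq> s" and xy: "x \<leadsto> y"
  shows False
proof -
  have iff: "p = x \<or> p \<leadsto> x \<or> p = s \<or> p \<leadsto> s \<longleftrightarrow> p = y \<or> p \<leadsto> y \<or> p = s \<or> p \<leadsto> s" for p
    using eq by (auto simp: set_eq_iff mem_closed_in_nbhd_set)
  have in_x: "z = s \<or> z \<leadsto> s" if "z \<leadsto> x" "z \<noteq> y" for z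
    using iff[of z] that no_F1[of z x y] xy by blast
  show False
  proof (cases "y \<leadsto> x")
    case True
    obtain z where z: "z \<leadsto> x" "z \<noteq> y" using second_on_digon[OF xy True] by blast
    obtain z' where z': "z' \<leadsto> y" "z' \<noteq> x" using second_on_digon[OF True xy] by blast
    have "z = s \<or> z \<leadsto> s" "z' = s \<or> z' \<leadsto> s"
      using iff[of z] iff[of z'] z z' no_F1[of z x y] no_F1[of z' y x] xy True by blast+
    moreover have "z \<noteq> z'" using z z' no_F1[of z x y] xy by blast
    ultimately consider "z = s" "z' \<leadsto> s" | "z \<leadsto> s" "z' = s" | "z \<leadsto> s" "z' \<leadsto> s" by blast
    then show False
    proof cases
      case 1
      then show False using no_F3[of z' s x y] z z' True ne by blast
    next
      case 2
      then show False using no_F3[of z s y x] z z' xy ne by blast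
    next
      case 3
      then show False using no_F6[of z s x y z'] z z' xy ne \<open>z \<noteq> z'\<close> by blast
    qed
  next
    case False
    then have ys: "y \<leadsto> s" using iff[of y] ne by blast
    have only_s: "z = s" if "z \<leadsto> x" for z
      using in_x[OF that] that no_F4[of z x y s] xy ys False ne by blast
    then have "s \<leadsto> x" using in_neighbour[OF in_arcsD1[OF xy]] by blast
    then show False using second_on_triangle[OF xy ys] only_s by blast
  qed
qed

text \<open>
  Without an arc between \<open>x\<close> and \<open>y\<close>, both have \<open>s\<close> as out-neighbour, and \<open>x\<close> has in-degree one on a
  digon with \<open>s\<close>.
\<close>

lemma overlapping_pairs:
  assumes eq: "closed_in_nbhd_set G {x, s} = closed_in_nbhd_set G {y, s}"
    and ne: "x \<noteq> y" "x \<noteq> s" "y \<noteq> s"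
  shows False
proof -
  have nxy: "\<not> x \<leadsto> y" "\<not> y \<leadsto> x"
    using overlapping_pairs_arc[OF eq ne] overlapping_pairs_arc[OF eq[symmetric] ne(1)[symmetric] ne(3,2)]
    by blast+
  have iff: "p = x \<or> p \<leadsto> x \<or> p = s \<or> p \<leadsto> s \<longleftrightarrow> p = y \<or> p \<leadsto> y \<or> p = s \<or> p \<leadsto> s" for p
    using eq by (auto simp: set_eq_iff mem_closed_in_nbhd_set)
  have xs: "x \<leadsto> s" and ys: "y \<leadsto> s"
    using iff[of x] iff[of y] nxy ne by blast+
  have only_s: "z = s" if "z \<leadsto> x" for z
    using iff[of z] that nxy no_F1[of z x s] no_F3[of z x s y] xs ys ne by blast
  then have "s \<leadsto> x" using in_neighbour[OF in_arcsD1[OF xs]] by blast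
  then show False using second_on_digon[OF xs] only_s by blast
qed

lemma disjoint_pairs_mixed:
  assumes eq: "closed_in_nbhd_set G {x1, x2} = closed_in_nbhd_set G {y1, y2}"
    and ne: "x1 \<noteq> x2" "y1 \<noteq> y2" "x1 \<noteq> y1" "x1 \<noteq> y2" "x2 \<noteq> y1" "x2 \<noteq> y2"
    and d: "x1 \<leadsto> y1" "y1 \<leadsto> x1"
    and z: "z \<leadsto> x1" "z \<leadsto> y2" "z \<noteq> y1" and x2y1: "x2 \<leadsto> y1"
  shows False
proof -
  have iff: "p = x1 \<or> p \<leadsto> x1 \<or> p = x2 \<or> p \<leadsto> x2 \<longleftrightarrow> p = y1 \<or> p \<leadsto> y1 \<or> p = y2 \<or> p \<leadsto> y2" for p
    using eq by (auto simp: set_eq_iff mem_closed_in_nbhd_set)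
  have "\<not> y2 \<leadsto> x1" using no_F1[of z y2 x1] z by blast
  then have y2x2: "y2 \<leadsto> x2" using iff[of y2] ne by blast
  have "z \<noteq> x2" using no_F1[of x2 y1 x1] z d x2y1 by blast
  then show False
    using no_F5[of z x1 y1 y2 x2] z d y2x2 x2y1 ne by blast
qed

text \<open>
  The two ends of the digon have further in-neighbours \<open>z\<close> and \<open>z'\<close>, accounted for by \<open>y2\<close> and \<open>x2\<close>
  respectively. Each of them is the accounting vertex itself or an in-neighbour of it, which gives the
  four cases.
\<close>

lemma disjoint_pairs_digon:
  assumes eq: "closed_in_nbhd_set G {x1, x2} = closed_in_nbhd_set G {y1, y2}"
    and ne: "x1 \<noteq> x2" "y1 \<noteq> y2" "x1 \<noteq> y1" "x1 \<noteq> y2" "x2 \<noteq> y1" "x2 \<noteq> y2"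
    and d: "x1 \<leadsto> y1" "y1 \<leadsto> x1"
  shows False
proof -
  have iff: "p = x1 \<or> p \<leadsto> x1 \<or> p = x2 \<or> p \<leadsto> x2 \<longleftrightarrow> p = y1 \<or> p \<leadsto> y1 \<or> p = y2 \<or> p \<leadsto> y2" for p
    using eq by (auto simp: set_eq_iff mem_closed_in_nbhd_set)
  obtain z where z: "z \<leadsto> x1" "z \<noteq> y1" using second_on_digon[OF d] by blast
  obtain z' where z': "z' \<leadsto> y1" "z' \<noteq> x1" using second_on_digon[OF d(2,1)] by blast
  have zz': "z = y2 \<or> z \<leadsto> y2" "z' = x2 \<or> z' \<leadsto> x2"
    using iff[of z] iff[of z'] z z' no_F1[of z x1 y1] no_F1[of z' y1 x1] d by blast+
  have "z \<noteq> z'" using no_F1[of z x1 y1] z z' d by blast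
  consider (1) "z = y2" "z' = x2" | (2) "z \<leadsto> y2" "z' = x2" | (3) "z = y2" "z' \<leadsto> x2"
    | (4) "z \<leadsto> y2" "z' \<leadsto> x2"
    using zz' by blast
  then show False
  proof cases
    case 1
    then have y2x1: "y2 \<leadsto> x1" and x2y1: "x2 \<leadsto> y1" using z z' by auto
    have nx2y2: "\<not> x2 \<leadsto> y2" using no_F3[of x2 y2 x1 y1] y2x1 x2y1 d ne by blast
    have ny2x2: "\<not> y2 \<leadsto> x2" using no_F3[of y2 x2 y1 x1] y2x1 x2y1 d ne by blast
    have only_y1: "t = y1" if t: "t \<leadsto> x2" for t
    proof (rule ccontr)
      assume "t \<noteq> y1"
      have "\<not> t \<leadsto> y1" using no_F1[of t x2 y1] t x2y1 by blast
      with iff[of t] t \<open>t \<noteq> y1\<close> ny2x2 have "t \<leadsto> y2" by blast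
      moreover have "t \<noteq> x1" using no_F1[of x1 x2 y1] t x2y1 d by blast
      ultimately show False
        using no_F5[of t y2 x1 x2 y1] t x2y1 y2x1 d ne \<open>t \<noteq> y1\<close> by blast
    qed
    then have "y1 \<leadsto> x2" using in_neighbour[OF in_arcsD1[OF x2y1]] by blast
    then show False using second_on_digon[OF x2y1] only_y1 by blast
  next
    case 2
    then show False using disjoint_pairs_mixed[OF eq ne d] z z' by blast
  next
    case 3
    then show False
      using disjoint_pairs_mixed[OF eq[symmetric] ne(2,1) ne(3)[symmetric] ne(5)[symmetric]
          ne(4)[symmetric] ne(6)[symmetric] d(2,1)] z z' by blast
  next
    case 4
    have "\<not> y2 \<leadsto> x1" using no_F1[of z y2 x1] z 4 by blast
    then have y2x2: "y2 \<leadsto> x2" using iff[of y2] ne by blast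
    have "\<not> x2 \<leadsto> y1" using no_F1[of z' x2 y1] z' 4 by blast
    then have x2y2: "x2 \<leadsto> y2" using iff[of x2] ne by blast
    have "z \<noteq> x2" using no_F3[of z' y1 x1 x2] z z' d 4 ne by blast
    have "z' \<noteq> y2" using no_F3[of z x1 y1 y2] z z' d 4 ne by blast
    show False
      using no_F11[of z y2 x2 x1 y1 z'] z z' d 4 y2x2 ne \<open>z \<noteq> z'\<close> \<open>z \<noteq> x2\<close> \<open>z' \<noteq> y2\<close> by blast
  qed
qed

text \<open>
  Without digons, the arcs that cover the four vertices run around a square, and each further
  in-neighbour of a vertex on the square forms \<open>F1\<close>.
\<close>

lemma disjoint_pairs:
  assumes eq: "closed_in_nbhd_set G {x1, x2} = closed_in_nbhd_set G {y1, y2}"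
    and ne: "x1 \<noteq> x2" "y1 \<noteq> y2" "x1 \<noteq> y1" "x1 \<noteq> y2" "x2 \<noteq> y1" "x2 \<noteq> y2"
    and arc: "x1 \<leadsto> y1"
  shows False
proof -
  have iff: "p = x1 \<or> p \<leadsto> x1 \<or> p = x2 \<or> p \<leadsto> x2 \<longleftrightarrow> p = y1 \<or> p \<leadsto> y1 \<or> p = y2 \<or> p \<leadsto> y2" for p
    using eq by (auto simp: set_eq_iff mem_closed_in_nbhd_set)
  have "\<not> y1 \<leadsto> x1" using disjoint_pairs_digon[OF eq ne arc] by blast
  then have y1x2: "y1 \<leadsto> x2" using iff[of y1] ne by blast
  have "\<not> x2 \<leadsto> y1"
    using disjoint_pairs_digon[of x2 x1 y1 y2] eq ne y1x2 by (metis insert_commute)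
  then have x2y2: "x2 \<leadsto> y2" using iff[of x2] ne by blast
  have "\<not> y2 \<leadsto> x2"
    using disjoint_pairs_digon[of x2 x1 y2 y1] eq ne x2y2 by (metis insert_commute)
  then have y2x1: "y2 \<leadsto> x1" using iff[of y2] ne by blast
  obtain t where t: "t \<leadsto> x1" "t \<noteq> y2"
    using second_on_square[OF arc y1x2 x2y2 y2x1 ne(1,2)] by blast
  then show False
    using iff[of t] no_F1[of t x1 y1] no_F1[of t y2 x1] arc y2x1 \<open>\<not> y1 \<leadsto> x1\<close> by blast
qed

lemma identifying_code_2:
  assumes twin_free: "twin_free G"
  shows "admits_identifying_code G 2"
proof (rule admits_identifying_codeI)
  fix X Y
  assume V: "X \<subseteq> pverts G" "Y \<subseteq> pverts G" and "X \<noteq> Y"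
    and cards: "1 \<le> card X" "card X \<le> 2" "1 \<le> card Y" "card Y \<le> 2"
    and eq: "closed_in_nbhd_set G X = closed_in_nbhd_set G Y"
  have form: "(\<exists>a. A = {a}) \<or> (\<exists>a b. A = {a, b} \<and> a \<noteq> b)" if "1 \<le> card A" "card A \<le> 2"
    for A :: "'a set"
    using that by (metis One_nat_def Suc_1 card_1_singleton_iff card_2_iff le_Suc_eq le_antisym)
  consider (11) x y where "X = {x}" "Y = {y}"
    | (12) x y1 y2 where "X = {x}" "Y = {y1, y2}" "y1 \<noteq> y2"
    | (21) y x1 x2 where "Y = {y}" "X = {x1, x2}" "x1 \<noteq> x2"
    | (22) x1 x2 y1 y2 where "X = {x1, x2}" "x1 \<noteq> x2" "Y = {y1, y2}" "y1 \<noteq> y2"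
    using form[OF cards(1,2)] form[OF cards(3,4)] by blast
  then show False
  proof cases
    case 11
    then have "twins G x y"
      using eq V \<open>X \<noteq> Y\<close> by (auto simp: twins_def closed_in_nbhd_set_def)
    then show False using twin_free by (auto simp: twin_free_def)
  next
    case 12
    then show False using singleton_vs_pair eq by blast
  next
    case 21
    then show False using singleton_vs_pair eq by metis
  next
    case 22
    show False
    proof (cases "X \<inter> Y = {}")
      case True
      then have ne: "x1 \<noteq> x2" "y1 \<noteq> y2" "x1 \<noteq> y1" "x1 \<noteq> y2" "x2 \<noteq> y1" "x2 \<noteq> y2" using 22 by auto
      have "x1 \<in> closed_in_nbhd_set G X" using 22(1) by (simp add: mem_closed_in_nbhd_set)
      then have "x1 \<leadsto> y1 \<or> x1 \<leadsto> y2"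
        unfolding eq using 22(3) ne by (simp add: mem_closed_in_nbhd_set)
      then show False
        using disjoint_pairs[of x1 x2 y1 y2] disjoint_pairs[of x1 x2 y2 y1] eq 22 ne
        by (metis insert_commute)
    next
      case False
      then obtain s where s: "s \<in> X" "s \<in> Y" by blast
      obtain x where "X = {x, s}" "x \<noteq> s" using 22(1,2) s(1) by blast
      moreover obtain y where "Y = {y, s}" "y \<noteq> s" using 22(3,4) s(2) by blast
      ultimately show False using overlapping_pairs eq \<open>X \<noteq> Y\<close> by blast
    qed
  qed
qed

end

section \<open>The five criteria\<close>

context pair_wf_digraph
begin

lemma digon_is_cycle:
  assumes "u \<leadsto> v" "v \<leadsto> u" "u \<noteq> v"
  shows "on_cycle_of_length G 2 u"
  unfolding on_cycle_of_length_def cycle_def awalk_def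
  using assms by (intro exI[of _ "[(u, v), (v, u)]"]) (auto dest: in_arcsD1 intro!: exI[of _ u])

lemma triangle_is_cycle:
  assumes "u \<leadsto> v" "v \<leadsto> w" "w \<leadsto> u" "u \<noteq> v" "u \<noteq> w" "v \<noteq> w"
  shows "on_cycle_of_length G 3 u"
  unfolding on_cycle_of_length_def cycle_def awalk_def
  using assms
  by (intro exI[of _ "[(u, v), (v, w), (w, u)]"]) (auto dest: in_arcsD1 intro!: exI[of _ u])

lemma square_is_cycle:
  assumes "u \<leadsto> v" "v \<leadsto> w" "w \<leadsto> t" "t \<leadsto> u" "distinct [u, v, w, t]"
  shows "on_cycle_of_length G 4 u"
  unfolding on_cycle_of_length_def cycle_def awalk_def
  using assms
  by (intro exI[of _ "[(u, v), (v, w), (w, t), (t, u)]"]) (auto dest: in_arcsD1 intro!: exI[of _ u])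

end

lemma (in pair_digraph) in_degree_one_off_short_cyclesI:
  assumes F: "\<forall>F\<in>{F1, F3, F4, F5, F6, F11}. \<not> contains_subdigraph G F"
    and deg: "\<And>u. u \<in> pverts G \<Longrightarrow> 1 \<le> card (in_nbhd G u)"
    and cyc: "\<And>u k. \<lbrakk>u \<in> pverts G; card (in_nbhd G u) = 1; k < 5\<rbrakk> \<Longrightarrow> \<not> on_cycle_of_length G k u"
  shows "in_degree_one_off_short_cycles G"
proof -
  have second: "\<exists>z. z \<leadsto> u \<and> z \<noteq> v" if "on_cycle_of_length G k u" "k < 5" "u \<in> pverts G" for u v k
  proof (rule ccontr)
    assume "\<not> ?thesis"
    then have "in_nbhd G u \<subseteq> {v}" by (auto simp: in_nbhd_def)
    from card_mono[OF _ this] have "card (in_nbhd G u) = 1"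
      using deg[OF that(3)] by simp
    with cyc[OF that(3) _ that(2)] that(1) show False by simp
  qed
  show ?thesis
  proof unfold_locales
    show "\<exists>z. z \<leadsto> u" if "u \<in> pverts G" for u
    proof -
      have "in_nbhd G u \<noteq> {}" using deg[OF that] by auto
      then show ?thesis by (auto simp: in_nbhd_def)
    qed
    show "\<exists>z. z \<leadsto> u \<and> z \<noteq> v" if "u \<leadsto> v" "v \<leadsto> u" for u v
      using second[OF digon_is_cycle[OF that]] that no_loops' by (auto dest: in_arcsD1)
    show "\<exists>z. z \<leadsto> u \<and> z \<noteq> w" if "u \<leadsto> v" "v \<leadsto> w" "w \<leadsto> u" for u v w
    proof -
      have "u \<noteq> v" "u \<noteq> w" "v \<noteq> w" using that by auto
      then show ?thesis using second[OF triangle_is_cycle[OF that]] that by (auto dest: in_arcsD1)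
    qed
    show "\<exists>z. z \<leadsto> u \<and> z \<noteq> t"
      if "u \<leadsto> v" "v \<leadsto> w" "w \<leadsto> t" "t \<leadsto> u" "u \<noteq> w" "v \<noteq> t" for u v w t
    proof -
      have "distinct [u, v, w, t]" using that by auto
      then show ?thesis using second[OF square_is_cycle[OF that(1-4)]] that by (auto dest: in_arcsD1)
    qed
  qed (use F in auto)
qed

theorem theorem2:
  fixes D :: "'a pair_pre_digraph"
  assumes "pair_digraph D"
    and "pverts D \<noteq> {}"
    and "twin_free D"
    and "1 \<le> min_in_degree D"
  shows
    "(2 \<le> min_in_degree D \<and> (\<forall>F\<in>{F1, F2}. \<not> contains_subdigraph D F)
        \<longrightarrow> admits_identifying_code D (min_in_degree D - 1))
     \<and> (oriented D \<and> (\<forall>F\<in>{F1, F2}. \<not> contains_subdigraph D F)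
        \<longrightarrow> admits_identifying_code D (min_in_degree D))
     \<and> ((\<forall>F\<in>{F1, F2, F3, F4, F5, F6, F7, F8, F9}. \<not> contains_subdigraph D F)
        \<longrightarrow> admits_identifying_code D (min_in_degree D))
     \<and> (2 \<le> min_in_degree D
        \<and> (\<forall>u\<in>pverts D. in_degree (with_proj D) u = min_in_degree D \<longrightarrow> \<not> on_digon D u)
        \<and> (\<forall>F\<in>{F1, F2, F3, F4, F5, F6, F7, F8, F9, F10, F11}. \<not> contains_subdigraph D F)
        \<longrightarrow> admits_identifying_code D (min_in_degree D + 1))
     \<and> (min_in_degree D = 1
        \<and> (\<forall>u\<in>pverts D. in_degree (with_proj D) u = 1
             \<longrightarrow> (\<forall>k<5. \<not> on_cycle_of_length D k u))
        \<and> (\<forall>F\<in>{F1, F3, F4, F5, F6, F11}. \<not> contains_subdigraph D F)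
        \<longrightarrow> admits_identifying_code D 2)"
proof -
  interpret pair_digraph D by fact
  define \<delta> where "\<delta> = min_in_degree D"
  have \<delta>: "\<delta> \<le> card (in_nbhd D u)" if "u \<in> pverts D" for u
    using min_in_degree_le[OF that] by (simp add: \<delta>_def)
  have \<delta>': "\<delta> - 1 \<le> card (in_nbhd D x - {s})" if "(x, s) \<in> parcs D" for x s
    using \<delta>[OF in_arcsD1[OF that]] card_Diff1_le[of "in_nbhd D x" s]
      card_Diff_singleton_if[of "in_nbhd D x" s] by (auto split: if_splits)
  have not_in: "card (in_nbhd D x - {s}) = card (in_nbhd D x)" if "(s, x) \<notin> parcs D" for x s
    using that by (simp add: in_nbhd_def)

  have forbidding_two: "admits_identifying_code D (\<delta> - 1)"
    if "\<forall>F\<in>{F1, F2}. \<not> contains_subdigraph D F"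
    using that \<delta>' by (intro identifying_code_if_many_in_neighbours) auto

  have forbidding_two_oriented: "admits_identifying_code D \<delta>"
    if "oriented D" "\<forall>F\<in>{F1, F2}. \<not> contains_subdigraph D F"
  proof (rule identifying_code_if_many_in_neighbours)
    show "\<delta> \<le> card (in_nbhd D x - {s})" if "(x, s) \<in> parcs D" for x s
      using \<open>oriented D\<close> that not_in[of s x] \<delta>[OF in_arcsD1[OF that]]
      by (auto simp: oriented_def digon_def)
  qed (use that in auto)

  have forbidding_nine: "admits_identifying_code D \<delta>"
    if "\<forall>F\<in>{F1, F2, F3, F4, F5, F6, F7, F8, F9}. \<not> contains_subdigraph D F"
  proof (rule identifying_code_if_tight[OF that \<open>twin_free D\<close>])
    show "\<delta> \<le> Suc (card (in_nbhd D x - {s}))" if "(x, s) \<in> parcs D" for x s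
      using \<delta>'[OF that] by simp
  qed (use \<delta> in blast)

  have forbidding_eleven: "admits_identifying_code D (\<delta> + 1)"
    if "2 \<le> \<delta>" "\<forall>u\<in>pverts D. in_degree (with_proj D) u = \<delta> \<longrightarrow> \<not> on_digon D u"
      "\<forall>F\<in>{F1, F2, F3, F4, F5, F6, F7, F8, F9, F10, F11}. \<not> contains_subdigraph D F"
  proof (rule identifying_code_if_tight[OF _ \<open>twin_free D\<close>])
    show "\<delta> + 1 \<le> Suc (card (in_nbhd D x - {s}))" if xs: "(x, s) \<in> parcs D" for x s
    (* Removing s costs one in-neighbour only on a digon, and there the in-degree exceeds the
       minimum. *)
    proof (cases "(s, x) \<in> parcs D")
      case True
      then have "on_digon D x" using xs by (auto simp: on_digon_def digon_def)
      then have "card (in_nbhd D x) \<noteq> \<delta>"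
        using \<open>\<forall>u\<in>pverts D. in_degree (with_proj D) u = \<delta> \<longrightarrow> \<not> on_digon D u\<close> in_arcsD1[OF xs]
        by (auto simp: in_degree_eq_card_in_nbhd)
      moreover have "s \<in> in_nbhd D x" using True by (simp add: in_nbhd_def)
      ultimately show ?thesis
        using \<delta>[OF in_arcsD1[OF xs]] finite_in_nbhd[of x] by simp
    next
      case False
      then show ?thesis using not_in \<delta>[OF in_arcsD1[OF xs]] by simp
    qed
  qed (use that in auto)

  have min_in_degree_one: "admits_identifying_code D 2"
    if "\<delta> = 1"
      "\<forall>u\<in>pverts D. in_degree (with_proj D) u = 1 \<longrightarrow> (\<forall>k<5. \<not> on_cycle_of_length D k u)"
      "\<forall>F\<in>{F1, F3, F4, F5, F6, F11}. \<not> contains_subdigraph D F"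
  proof (rule in_degree_one_off_short_cycles.identifying_code_2[OF _ \<open>twin_free D\<close>])
    show "in_degree_one_off_short_cycles D"
      using that \<delta> by (intro in_degree_one_off_short_cyclesI) (auto simp: in_degree_eq_card_in_nbhd)
  qed

  from forbidding_two forbidding_two_oriented forbidding_nine forbidding_eleven min_in_degree_one
  show ?thesis
    unfolding \<delta>_def by blast
qed

end
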